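(* Let $(\mathfrak a,\triangleright)$ be a post-Lie ring. Then setting $\mathfrak a_0=\mathfrak a$ and $\mathfrak a_i=L^i(\mathfrak a)$ for $i\ge1$ makes $(\mathfrak a,\triangleright)$ into a filtered post-Lie ring.
   Context: A post-Lie ring $(\mathfrak a,\triangleright)$ is a Lie ring $\mathfrak a$ (Lie algebra over $\mathbb Z$) with a biadditive map $\triangleright:\mathfrak a\times\mathfrak a\to\mathfrak a$ such that $x\triangleright[y,z]=[x\triangleright y,z]+[y,x\triangleright z]$ and $[x,y]\triangleright z=(x,y,z)-(y,x,z)$, where $(x,y,z)=x\triangleright(y\triangleright z)-(x\triangleright y)\triangleright z$. Define $L^1(\mathfrak a)=\mathfrak a$ and let $L^{i+1}(\mathfrak a)$ be the subgroup of $(\mathfrak a,+)$ generated by all $a\triangleright b$ and $[a,b]$ with $a\in\mathfrak a$, $b\in L^i(\mathfrak a)$. A strong left ideal of $(\mathfrak a,\triangleright)$ is an ideal $I$ of the Lie ring $\mathfrak a$ with $x\triangleright y\in I$ for all $x\in\mathfrak a$, $y\in I$. A filtered post-Lie ring is a post-Lie ring with a descending chain $\mathfrak a=\mathfrak a_0\supseteq\mathfrak a_1\supseteq\cdots$ of strong left ideals such that $[\mathfrak a_i,\mathfrak a_j]\subseteq\mathfrak a_{i+j}$ for all $i,j$. *)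

theory Defs
  imports "HOL-Algebra.AbelCoset" "HOL-Algebra.Generated_Groups"
begin

(* Only the additive group of the record is used: the fields mult and one are irrelevant. *)

definition biadditive :: "('a, 'b) ring_scheme \<Rightarrow> ('a \<Rightarrow> 'a \<Rightarrow> 'a) \<Rightarrow> bool" where
  "biadditive A f \<longleftrightarrow>
     (\<forall>x\<in>carrier A. \<forall>y\<in>carrier A. f x y \<in> carrier A) \<and>
     (\<forall>x\<in>carrier A. \<forall>y\<in>carrier A. \<forall>z\<in>carrier A. f (x \<oplus>\<^bsub>A\<^esub> y) z = f x z \<oplus>\<^bsub>A\<^esub> f y z) \<and>
     (\<forall>x\<in>carrier A. \<forall>y\<in>carrier A. \<forall>z\<in>carrier A. f x (y \<oplus>\<^bsub>A\<^esub> z) = f x y \<oplus>\<^bsub>A\<^esub> f x z)"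

locale lie_ring = abelian_group A for A (structure) +
  fixes br :: "'a \<Rightarrow> 'a \<Rightarrow> 'a"
  assumes br_biadditive: "biadditive A br"
    and br_alternating: "x \<in> carrier A \<Longrightarrow> br x x = \<zero>"
    and jacobi: "\<lbrakk>x \<in> carrier A; y \<in> carrier A; z \<in> carrier A\<rbrakk> \<Longrightarrow>
      br x (br y z) \<oplus> br y (br z x) \<oplus> br z (br x y) = \<zero>"

definition associator :: "('a, 'b) ring_scheme \<Rightarrow> ('a \<Rightarrow> 'a \<Rightarrow> 'a) \<Rightarrow> 'a \<Rightarrow> 'a \<Rightarrow> 'a \<Rightarrow> 'a" where
  "associator A tri x y z = tri x (tri y z) \<ominus>\<^bsub>A\<^esub> tri (tri x y) z"

locale post_lie_ring = lie_ring A br for A (structure) and br +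
  fixes tri :: "'a \<Rightarrow> 'a \<Rightarrow> 'a"
  assumes tri_biadditive: "biadditive A tri"
    and tri_br: "\<lbrakk>x \<in> carrier A; y \<in> carrier A; z \<in> carrier A\<rbrakk> \<Longrightarrow>
      tri x (br y z) = br (tri x y) z \<oplus> br y (tri x z)"
    and br_tri: "\<lbrakk>x \<in> carrier A; y \<in> carrier A; z \<in> carrier A\<rbrakk> \<Longrightarrow>
      tri (br x y) z = associator A tri x y z \<ominus> associator A tri y x z"

(* Indexed from 1 as in the usual convention; the value at index 0 is a dummy. *)
fun L_series ::
  "('a, 'b) ring_scheme \<Rightarrow> ('a \<Rightarrow> 'a \<Rightarrow> 'a) \<Rightarrow> ('a \<Rightarrow> 'a \<Rightarrow> 'a) \<Rightarrow> nat \<Rightarrow> 'a set" where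
  "L_series A br tri 0 = {}"
| "L_series A br tri (Suc 0) = carrier A"
| "L_series A br tri (Suc (Suc i)) =
     generate (add_monoid A)
       ({tri a b | a b. a \<in> carrier A \<and> b \<in> L_series A br tri (Suc i)} \<union>
        {br a b | a b. a \<in> carrier A \<and> b \<in> L_series A br tri (Suc i)})"

definition lie_ideal :: "('a, 'b) ring_scheme \<Rightarrow> ('a \<Rightarrow> 'a \<Rightarrow> 'a) \<Rightarrow> 'a set \<Rightarrow> bool" where
  "lie_ideal A br I \<longleftrightarrow>
     additive_subgroup I A \<and> (\<forall>x\<in>carrier A. \<forall>y\<in>I. br x y \<in> I)"

definition strong_left_ideal ::
  "('a, 'b) ring_scheme \<Rightarrow> ('a \<Rightarrow> 'a \<Rightarrow> 'a) \<Rightarrow> ('a \<Rightarrow> 'a \<Rightarrow> 'a) \<Rightarrow> 'a set \<Rightarrow> bool" where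
  "strong_left_ideal A br tri I \<longleftrightarrow>
     lie_ideal A br I \<and> (\<forall>x\<in>carrier A. \<forall>y\<in>I. tri x y \<in> I)"

locale filtered_post_lie_ring = post_lie_ring A br tri for A (structure) and br and tri +
  fixes F :: "nat \<Rightarrow> 'a set"
  assumes F_0: "F 0 = carrier A"
    and F_descending: "F (Suc i) \<subseteq> F i"
    and F_strong_left_ideal: "strong_left_ideal A br tri (F i)"
    and F_br: "\<lbrakk>x \<in> F i; y \<in> F j\<rbrakk> \<Longrightarrow> br x y \<in> F (i + j)"

end

theory Submission
  imports Defs
begin

text \<open>
  Write \<open>L\<^sup>i\<close> for the \<open>i\<close>-th term of the series. For each \<open>a\<close>, both \<open>D = br a\<close>
  and \<open>D = tri a\<close> map \<open>L\<^sup>i\<close> into \<open>L\<^sup>i\<^sup>+\<^sup>1\<close>, and the elements \<open>D b\<close> with \<open>b\<close> in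
  \<open>L\<^sup>i\<close> generate \<open>L\<^sup>i\<^sup>+\<^sup>1\<close>. The series descends by induction, so each term is stable under
  every \<open>D\<close>, that is, it is a strong left ideal.

  The inclusion of \<open>br (L\<^sup>i) (L\<^sup>j)\<close> in \<open>L\<^sup>i\<^sup>+\<^sup>j\<close> rests on the fact that both kinds of operator \<open>D\<close>
  are derivations of the bracket: \<open>br a\<close> by the Jacobi identity, \<open>tri a\<close> by an axiom.
  In an induction on \<open>i\<close> for all \<open>j\<close>, with \<open>y\<close> in \<open>L\<^sup>j\<close> fixed, the elements \<open>x\<close> with \<open>br x y \<in> L\<^sup>i\<^sup>+\<^sup>1\<^sup>+\<^sup>j\<close> form a subgroup,
  so only generators \<open>x = D b\<close> with \<open>b\<close> in \<open>L\<^sup>i\<close> matter, and for these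
  \<open>br (D b) y = D (br b y) - br b (D y)\<close>. The induction hypothesis puts \<open>br b y\<close> in
  \<open>L\<^sup>i\<^sup>+\<^sup>j\<close> and \<open>br b (D y)\<close> in \<open>L\<^sup>i\<^sup>+\<^sup>j\<^sup>+\<^sup>1\<close>, and \<open>D\<close> raises the degree of the first by one.
\<close>

text \<open>Simplification should keep \<open>L_series\<close> folded: the arguments concern degrees and closure
  properties, and the generators enter only where a term is entered or tested on them.\<close>

declare L_series.simps(3) [simp del]

context lie_ring
begin

lemma br_closed: "\<lbrakk>x \<in> carrier A; y \<in> carrier A\<rbrakk> \<Longrightarrow> br x y \<in> carrier A"
  using br_biadditive by (simp add: biadditive_def)

lemma br_add_left:
  "\<lbrakk>x \<in> carrier A; y \<in> carrier A; z \<in> carrier A\<rbrakk> \<Longrightarrow> br (x \<oplus> y) z = br x z \<oplus> br y z"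
  using br_biadditive by (simp add: biadditive_def)

lemma br_add_right:
  "\<lbrakk>x \<in> carrier A; y \<in> carrier A; z \<in> carrier A\<rbrakk> \<Longrightarrow> br x (y \<oplus> z) = br x y \<oplus> br x z"
  using br_biadditive by (simp add: biadditive_def)

lemma br_zero_left:
  assumes "y \<in> carrier A" shows "br \<zero> y = \<zero>"
proof -
  have "br \<zero> y \<oplus> br \<zero> y = br \<zero> y"
    using br_add_left[of \<zero> \<zero> y] assms by simp
  then show ?thesis
    using br_closed[of \<zero> y] assms by (metis add.r_cancel_one' zero_closed)
qed

lemma br_minus_left:
  assumes "x \<in> carrier A" "y \<in> carrier A" shows "br (\<ominus> x) y = \<ominus> br x y"
proof -
  have "br (\<ominus> x) y \<oplus> br x y = \<zero>"
    using br_add_left[of "\<ominus> x" x y] assms by (simp add: l_neg br_zero_left)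
  then show ?thesis
    using br_closed assms by (metis a_inv_closed minus_equality)
qed

lemma br_antisym:
  assumes x: "x \<in> carrier A" and y: "y \<in> carrier A"
  shows "br y x = \<ominus> br x y"
proof -
  have "br (y \<oplus> x) (y \<oplus> x) = (br y y \<oplus> br x y) \<oplus> (br y x \<oplus> br x x)"
    using x y by (simp add: br_add_left br_add_right br_closed)
  then have "br y x \<oplus> br x y = \<zero>"
    using br_alternating x y by (simp add: br_closed a_comm)
  then have "\<ominus> br x y = br y x"
    by (rule minus_equality) (simp_all add: br_closed x y)
  then show ?thesis ..
qed

lemma br_minus_right:
  assumes "x \<in> carrier A" "y \<in> carrier A" shows "br x (\<ominus> y) = \<ominus> br x y"
  using assms by (metis a_inv_closed br_antisym br_minus_left)

text \<open>The Jacobi identity in the form in which \<open>br x\<close> acts as a derivation, so that it can be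
  treated together with \<open>tri x\<close>.\<close>

lemma br_leibniz:
  assumes x: "x \<in> carrier A" and y: "y \<in> carrier A" and z: "z \<in> carrier A"
  shows "br x (br y z) = br (br x y) z \<oplus> br y (br x z)"
proof -
  have "br y (br z x) = \<ominus> br y (br x z)" and "br z (br x y) = \<ominus> br (br x y) z"
    using x y z by (simp_all add: br_antisym[of x z] br_minus_right br_closed br_antisym[of "br x y" z])
  then have "br x (br y z) \<oplus> (\<ominus> br y (br x z) \<oplus> \<ominus> br (br x y) z) = \<zero>"
    using jacobi[OF x y z] x y z by (simp add: br_closed a_assoc)
  then have "br x (br y z) \<oplus> \<ominus> (br (br x y) z \<oplus> br y (br x z)) = \<zero>"
    using x y z by (simp add: br_closed minus_add a_comm)
  then show ?thesis
    using x y z by (metis a_closed br_closed a_inv_closed minus_equality minus_minus)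
qed

text \<open>This reduces membership statements about brackets to generators of the left argument.\<close>

lemma additive_subgroup_br_preimage:
  assumes H: "additive_subgroup H A" and y: "y \<in> carrier A"
  shows "additive_subgroup {x \<in> carrier A. br x y \<in> H} A"
proof -
  interpret H: additive_subgroup H A by (fact H)
  show ?thesis
  proof (rule additive_subgroup.intro, rule add.subgroupI)
    show "{x \<in> carrier A. br x y \<in> H} \<noteq> {}"
      using br_zero_left[OF y] H.zero_closed by auto
  next
    fix a assume "a \<in> {x \<in> carrier A. br x y \<in> H}"
    then show "\<ominus> a \<in> {x \<in> carrier A. br x y \<in> H}"
      using y by (simp add: br_minus_left)
  next
    fix a b assume "a \<in> {x \<in> carrier A. br x y \<in> H}" "b \<in> {x \<in> carrier A. br x y \<in> H}"
    then show "a \<oplus> b \<in> {x \<in> carrier A. br x y \<in> H}"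
      using y by (simp add: br_add_left)
  qed auto
qed

end

context post_lie_ring
begin

abbreviation L :: "nat \<Rightarrow> 'a set" where
  "L \<equiv> L_series A br tri"

lemma tri_closed: "\<lbrakk>x \<in> carrier A; y \<in> carrier A\<rbrakk> \<Longrightarrow> tri x y \<in> carrier A"
  using tri_biadditive by (simp add: biadditive_def)

lemma additive_subgroup_L_series: "additive_subgroup (L (Suc n)) A"
proof (induction n)
  case 0
  show ?case
    using add.subgroup_self by (simp add: additive_subgroup_def)
next
  case (Suc n)
  then have "b \<in> carrier A" if "b \<in> L (Suc n)" for b
    using that additive_subgroup.a_Hcarr by metis
  then have "{tri a b | a b. a \<in> carrier A \<and> b \<in> L (Suc n)} \<union>
      {br a b | a b. a \<in> carrier A \<and> b \<in> L (Suc n)} \<subseteq> carrier A"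
    using br_closed tri_closed by auto
  then show ?case
    unfolding L_series.simps by (rule additive_subgroupI[OF add.generate_is_subgroup])
qed

lemma L_series_carrier: "x \<in> L (Suc n) \<Longrightarrow> x \<in> carrier A"
  using additive_subgroup.a_subset[OF additive_subgroup_L_series] by blast

lemma br_L_series: "\<lbrakk>a \<in> carrier A; b \<in> L (Suc n)\<rbrakk> \<Longrightarrow> br a b \<in> L (Suc (Suc n))"
  unfolding L_series.simps by (rule generate.incl) blast

lemma tri_L_series: "\<lbrakk>a \<in> carrier A; b \<in> L (Suc n)\<rbrakk> \<Longrightarrow> tri a b \<in> L (Suc (Suc n))"
  unfolding L_series.simps by (rule generate.incl) blast

lemma L_series_Suc_subset:
  assumes "additive_subgroup H A"
    and "\<And>a b. \<lbrakk>a \<in> carrier A; b \<in> L (Suc n)\<rbrakk> \<Longrightarrow> tri a b \<in> H"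
    and "\<And>a b. \<lbrakk>a \<in> carrier A; b \<in> L (Suc n)\<rbrakk> \<Longrightarrow> br a b \<in> H"
  shows "L (Suc (Suc n)) \<subseteq> H"
  unfolding L_series.simps
  by (rule add.generate_subgroup_incl) (use assms in \<open>auto simp: additive_subgroup_def\<close>)

lemma L_series_descending: "L (Suc (Suc n)) \<subseteq> L (Suc n)"
proof (induction n)
  case 0
  show ?case
    using additive_subgroup.a_subset[OF additive_subgroup_L_series]
    unfolding L_series.simps(2) .
next
  case (Suc n)
  show ?case
  proof (rule L_series_Suc_subset[OF additive_subgroup_L_series])
    fix a b assume a: "a \<in> carrier A" and "b \<in> L (Suc (Suc n))"
    then have b: "b \<in> L (Suc n)"
      using Suc by (elim subsetD)
    show "tri a b \<in> L (Suc (Suc n))" "br a b \<in> L (Suc (Suc n))"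
      by (rule tri_L_series[OF a b], rule br_L_series[OF a b])
  qed
qed

lemma strong_left_ideal_L_series: "strong_left_ideal A br tri (L (Suc n))"
  unfolding strong_left_ideal_def lie_ideal_def
proof (intro conjI ballI)
  show "additive_subgroup (L (Suc n)) A"
    by (rule additive_subgroup_L_series)
next
  fix x y assume "x \<in> carrier A" "y \<in> L (Suc n)"
  then show "br x y \<in> L (Suc n)" "tri x y \<in> L (Suc n)"
    by (rule subsetD[OF L_series_descending br_L_series],
        rule subsetD[OF L_series_descending tri_L_series])
qed

text \<open>The inductive step of the bracket estimate for a single generator \<open>D b\<close>, with \<open>D\<close> standing
  for either \<open>br a\<close> or \<open>tri a\<close>. The degrees of \<open>b\<close> and \<open>y\<close> are \<open>m + 1\<close> and \<open>n + 1\<close>.\<close>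

lemma br_derivation_image_L_series:
  assumes D: "\<And>k c. c \<in> L (Suc k) \<Longrightarrow> D c \<in> L (Suc (Suc k))"
    and leibniz: "D (br b y) = br (D b) y \<oplus> br b (D y)"
    and IH: "\<And>k c. c \<in> L (Suc k) \<Longrightarrow> br b c \<in> L (Suc m + Suc k)"
    and b: "b \<in> L (Suc m)" and y: "y \<in> L (Suc n)"
  shows "br (D b) y \<in> L (Suc (Suc m) + Suc n)"
proof -
  interpret S: additive_subgroup "L (Suc (Suc (Suc (m + n))))" A
    by (rule additive_subgroup_L_series)
  have "D (br b y) \<in> L (Suc (Suc (Suc (m + n))))"
    using D[of "br b y" "Suc (m + n)"] IH[OF y] by simp
  moreover have *: "br b (D y) \<in> L (Suc (Suc (Suc (m + n))))"
    using IH[OF D[OF y]] by simp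
  moreover have "br (D b) y = D (br b y) \<ominus> br b (D y)"
    using L_series_carrier[OF b] L_series_carrier[OF y] L_series_carrier[OF D[OF b]]
      L_series_carrier[OF *]
    by (simp add: leibniz minus_eq a_assoc r_neg br_closed)
  ultimately show ?thesis
    by (simp add: minus_eq)
qed

lemma br_L_series_L_series:
  assumes "x \<in> L (Suc m)" "y \<in> L (Suc n)"
  shows "br x y \<in> L (Suc m + Suc n)"
  using assms
proof (induction m arbitrary: x y n)
  case 0
  then show ?case
    using br_L_series[of x y n] by simp
next
  case (Suc m)
  note y = \<open>y \<in> L (Suc n)\<close>
  let ?P = "{x \<in> carrier A. br x y \<in> L (Suc (Suc m) + Suc n)}"
  have "L (Suc (Suc m)) \<subseteq> ?P"
  proof (rule L_series_Suc_subset)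
    show "additive_subgroup ?P A"
      using additive_subgroup_br_preimage[OF additive_subgroup_L_series L_series_carrier[OF y]]
      by simp
  next
    fix a b assume a: "a \<in> carrier A" and b: "b \<in> L (Suc m)"
    note carr = a L_series_carrier[OF b] L_series_carrier[OF y]
    show "tri a b \<in> ?P"
      using br_derivation_image_L_series[where D = "tri a", OF tri_L_series[OF a] tri_br[OF carr]
          Suc.IH[OF b] b y] tri_closed carr by blast
    show "br a b \<in> ?P"
      using br_derivation_image_L_series[where D = "br a", OF br_L_series[OF a] br_leibniz[OF carr]
          Suc.IH[OF b] b y] br_closed carr by blast
  qed
  with Suc.prems(1) show ?case by blast
qed

end

theorem lemma3p7:
  fixes A :: "('a, 'b) ring_scheme"
    and br tri :: "'a \<Rightarrow> 'a \<Rightarrow> 'a"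
  assumes "post_lie_ring A br tri"
  shows "filtered_post_lie_ring A br tri
           (\<lambda>i. if i = 0 then carrier A else L_series A br tri i)"
proof -
  interpret post_lie_ring A br tri by (fact assms)
  let ?F = "\<lambda>i. if i = 0 then carrier A else L i"
  have ideal: "strong_left_ideal A br tri (?F i)" for i
    using strong_left_ideal_L_series[of 0] strong_left_ideal_L_series[of "i - 1"]
    by (cases i) simp_all
  show ?thesis
  proof unfold_locales
    show "?F 0 = carrier A" by simp
  next
    fix i show "?F (Suc i) \<subseteq> ?F i"
      using L_series_descending[of "i - 1"] by (cases i) simp_all
  next
    fix i show "strong_left_ideal A br tri (?F i)" by (rule ideal)
  next
    fix x y i j
    assume x: "x \<in> ?F i" and y: "y \<in> ?F j"
    have sub: "additive_subgroup (?F k) A" for k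
      using ideal by (simp add: strong_left_ideal_def lie_ideal_def)
    have carr: "x \<in> carrier A" "y \<in> carrier A"
      using additive_subgroup.a_Hcarr[OF sub] x y by blast+
    consider "i = 0" | "j = 0" | m n where "i = Suc m" "j = Suc n"
      by (metis not0_implies_Suc)
    then show "br x y \<in> ?F (i + j)"
    proof cases
      case 1
      have "br x y \<in> ?F j"
        using ideal[of j] y carr(1) unfolding strong_left_ideal_def lie_ideal_def by blast
      then show ?thesis
        unfolding 1 add_0 .
    next
      \<comment> \<open>Degree \<open>0\<close> on the right: a Lie ideal absorbs brackets from the left, hence by
        antisymmetry from the right.\<close>
      case 2
      have "br y x \<in> ?F i"
        using ideal[of i] x carr(2) unfolding strong_left_ideal_def lie_ideal_def by blast
      then have "\<ominus>\<^bsub>A\<^esub> br y x \<in> ?F i"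
        by (rule additive_subgroup.a_inv_closed[OF sub])
      then show ?thesis
        unfolding 2 add_0_right br_antisym[OF carr(2,1), symmetric] .
    next
      case 3
      then show ?thesis
        using br_L_series_L_series[of x m y n] x y by simp
    qed
  qed
qed

end
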